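(* Let $k \ge d$ be positive integers and $v_1, \ldots, v_k$ be directions in $\mathbb{R}^d$. Let $\mathcal{F}$ be a finite family of convex sets in $\mathbb{R}^d$. If the intersection of every $k+d$ sets in $\mathcal{F}$ contains a zonotope with directions $v_1, \ldots, v_k$ that has volume one, then $\bigcap \mathcal{F}$ contains a zonotope with directions $v_1, \ldots, v_k$ that has volume one.
   Context: Directions are nonzero vectors. A zonotope with directions $v_1, \ldots, v_k$ is a set of the form $p + \big((\alpha_1 v_1) \oplus \cdots \oplus (\alpha_k v_k)\big)$ with $p \in \mathbb{R}^d$ and $\alpha_1, \ldots, \alpha_k \ge 0$, where $\alpha_i v_i$ denotes the segment from $0$ to $\alpha_i v_i$ and $\oplus$ is the Minkowski sum. $\bigcap \mathcal{F}$ is the intersection of all sets in $\mathcal{F}$.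
   Formalization: The family F is assumed to have at least k+d members; without this the hypothesis on every k+d sets is vacuous and the claim fails, e.g. for the family whose only member is the empty set. *)

theory Defs
  imports "HOL-Analysis.Analysis"
begin

text \<open>The sum below is taken in the monoid of sets of \<open>HOL-Library.Set_Algebras\<close>, i.e. it is the
  Minkowski sum. Only the values of \<open>v\<close> on \<open>{1..k}\<close> matter.\<close>

definition zonotope_with_directions ::
    "nat \<Rightarrow> (nat \<Rightarrow> real ^ 'd) \<Rightarrow> (real ^ 'd) set \<Rightarrow> bool" where
  "zonotope_with_directions k v Z \<longleftrightarrow>
     (\<exists>p \<alpha>. (\<forall>i\<in>{1..k}. \<alpha> i \<ge> 0) \<and>
            Z = (+) p ` (\<Sum>i=1..k. closed_segment 0 (\<alpha> i *\<^sub>R v i)))"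

end

theory Submission
  imports Defs "HOL-Analysis.Finite_Function_Topology"
begin

text \<open>A zonotope with the given directions is determined by its base point and its \<open>k\<close> side lengths,
  i.e. by a point of a space of dimension \<open>d + k\<close>. By Brunn--Minkowski, the parameters of the zonotopes
  of volume at least one inside a fixed convex set form a convex set, so Helly's theorem in this space
  gives the result with \<open>k + d + 1\<close> in place of \<open>k + d\<close>. To save one dimension, project away the
  last side length: if several of these convex sets contain points with the same projection, then the
  one with the smallest last side length lies in all of them, because decreasing a side length
  keeps the zonotope inside each convex set. A zonotope of volume at least one is finally shrunk
  towards its base point.

  Brunn--Minkowski is proved in its multiplicative form by the Hadwiger--Ohmann argument: for finite
  packings of boxes one cuts by hyperplanes that split both volumes in the same ratio, until single
  boxes remain, where the claim is the weighted inequality of arithmetic and geometric means.\<close>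

subsection \<open>Helly's theorem in a finite-dimensional subspace\<close>

text \<open>The dimension \<open>k + d - 1\<close> of the parameter space is a term, so this space cannot be a type of
  class \<open>euclidean_space\<close>; it is a subspace of an infinite-dimensional type instead.\<close>

lemma affine_dependent_if_card_gt_span:
  fixes S T :: "'a::real_vector set"
  assumes "finite S" "finite T" "S \<subseteq> span T" "card S \<ge> card T + 2"
  shows "affine_dependent S"
proof -
  obtain a where a: "a \<in> S" using assms(4) by fastforce
  let ?D = "(\<lambda>x. - a + x) ` (S - {a})"
  have "?D \<subseteq> span T"
    using a assms(3) by (auto intro!: span_diff)
  moreover have "card ?D = card S - 1"
    using a assms(1) by (simp add: card_image)
  ultimately have "dependent ?D"
    using independent_span_bound[OF assms(2), of ?D] assms(4) by force
  then show ?thesis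
    using affine_dependent_iff_dependent2[OF a] by blast
qed

text \<open>Radon's argument, by induction on the number of sets. The family is indexed because
  distinct convex sets may have the same set of parameters, and counting must not merge
  them.\<close>

lemma Helly_span:
  fixes C :: "'i \<Rightarrow> 'a::real_vector set"
  assumes "finite T" "card T \<le> n" "finite I"
    and "\<And>i. i \<in> I \<Longrightarrow> convex (C i)"
    and "\<And>i. i \<in> I \<Longrightarrow> C i \<subseteq> span T"
    and "card I \<ge> n + 1"
    and "\<And>J. J \<subseteq> I \<Longrightarrow> card J = n + 1 \<Longrightarrow> (\<Inter>i\<in>J. C i) \<noteq> {}"
  shows "(\<Inter>i\<in>I. C i) \<noteq> {}"
  using assms(3-)
proof (induction "card I" arbitrary: I rule: less_induct)
  case less
  show ?case
  proof (cases "card I = n + 1")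
    case True
    then show ?thesis using less.prems(5) by blast
  next
    case False
    then have big: "card I \<ge> n + 2" using less.prems(4) by simp
    have "\<exists>x. x \<in> (\<Inter>j\<in>I-{i}. C j)" if "i \<in> I" for i
    proof -
      have "(\<Inter>j\<in>I-{i}. C j) \<noteq> {}"
      proof (rule less.hyps)
        show "card (I - {i}) < card I"
          using that less.prems(1) by (meson card_Diff1_less)
      next
        show "n + 1 \<le> card (I - {i})"
          using that big less.prems(1) by simp
      next
        fix J assume "J \<subseteq> I - {i}" "card J = n + 1"
        then show "(\<Inter>j\<in>J. C j) \<noteq> {}"
          by (intro less.prems(5)) auto
      qed (use less.prems(1-3) in auto)
      then show ?thesis by blast
    qed
    \<comment> \<open>\<open>X i\<close> is a common point of all the sets except possibly
      \<open>C i\<close>.\<close>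
    then obtain X where X: "\<And>i j. i \<in> I \<Longrightarrow> j \<in> I \<Longrightarrow> j \<noteq> i \<Longrightarrow> X i \<in> C j"
      unfolding INT_iff Ball_def Diff_iff singleton_iff by metis
    show ?thesis
    \<comment> \<open>Radon's theorem needs \<open>card I\<close> different points. If instead
      \<open>X i = X j\<close> with \<open>i \<noteq> j\<close>, this point already lies in every
      set: \<open>X i\<close> misses at most \<open>C i\<close>, and \<open>X j\<close> is in
      \<open>C i\<close>.\<close>
    proof (cases "inj_on X I")
      case False
      then obtain i j where ij: "i \<in> I" "j \<in> I" "i \<noteq> j" "X i = X j"
        unfolding inj_on_def by blast
      have "X i \<in> C l" if "l \<in> I" for l
        using X ij that by metis
      then show ?thesis by blast
    next
      case inj: True
      have "X i \<in> span T" if "i \<in> I" for i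
      proof -
        have "card (I - {i}) \<noteq> 0"
          using big that less.prems(1) by simp
        then obtain j where "j \<in> I" "j \<noteq> i"
          by (metis Diff_iff card.empty ex_in_conv singletonI)
        then show ?thesis using X less.prems(3) that by blast
      qed
      then have "affine_dependent (X ` I)"
        using less.prems(1) big assms(1,2)
        by (intro affine_dependent_if_card_gt_span[where T=T]) (auto simp: card_image inj)
      then obtain M P where MP: "M \<inter> P = {}" "M \<union> P = X ` I"
          "(convex hull M) \<inter> (convex hull P) \<noteq> {}"
        using Radon_partition[of "X ` I"] less.prems(1) by blast
      then obtain z where z: "z \<in> convex hull M" "z \<in> convex hull P" by blast
      \<comment> \<open>All points of \<open>N\<close> carry an index other than \<open>i\<close>,
        so they lie in the convex set \<open>C i\<close>, and so does their hull. As
        \<open>M\<close> and \<open>P\<close> are disjoint, \<open>X i\<close> is missing from one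
        of them.\<close>
      have hull: "z \<in> C i" if "z \<in> convex hull N" "N \<subseteq> X ` I" "X i \<notin> N" "i \<in> I" for N i
      proof -
        have "N \<subseteq> C i" using X that by fastforce
        then show ?thesis
          using that less.prems(2) by (meson hull_minimal subsetD)
      qed
      have "z \<in> C i" if "i \<in> I" for i
        using hull[OF z(1)] hull[OF z(2)] MP that by blast
      then show ?thesis by blast
    qed
  qed
qed

subsection \<open>The Brunn--Minkowski inequality\<close>

definition mixture :: "real \<Rightarrow> 'a::real_vector set \<Rightarrow> real \<Rightarrow> 'a set \<Rightarrow> 'a set" where
  "mixture u A v B = {u *\<^sub>R x + v *\<^sub>R y | x y. x \<in> A \<and> y \<in> B}"

lemma mixture_commute: "mixture u A v B = mixture v B u A"
  by (force simp: mixture_def add.commute)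

lemma mixture_mono: "A \<subseteq> A' \<Longrightarrow> B \<subseteq> B' \<Longrightarrow> mixture u A v B \<subseteq> mixture u A' v B'"
  by (auto simp: mixture_def)

lemma compact_mixture:
  fixes A B :: "'a::real_normed_vector set"
  assumes "compact A" "compact B"
  shows "compact (mixture u A v B)"
proof -
  have "mixture u A v B = {x + y | x y. x \<in> (*\<^sub>R) u ` A \<and> y \<in> (*\<^sub>R) v ` B}"
    by (auto simp: mixture_def)
  then show ?thesis
    using assms by (simp add: compact_sums compact_scaling)
qed

text \<open>Common faces are allowed, as in a division, but flat boxes are not, so every box has
  positive volume. Indexing lets a cut replace \<open>K i\<close> by \<open>K i \<inter> H\<close>
  under the same index, so that boxes are counted by indices.\<close>

definition box_packing :: "'i set \<Rightarrow> ('i \<Rightarrow> 'a::euclidean_space set) \<Rightarrow> bool" where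
  "box_packing I K \<longleftrightarrow> finite I \<and> I \<noteq> {} \<and> (\<forall>i\<in>I. \<exists>a b. K i = cbox a b) \<and>
     (\<forall>i\<in>I. interior (K i) \<noteq> {}) \<and> disjoint_family_on (\<lambda>i. interior (K i)) I"

abbreviation packing_volume :: "'i set \<Rightarrow> ('i \<Rightarrow> 'a::euclidean_space set) \<Rightarrow> real" where
  "packing_volume I K \<equiv> (\<Sum>i\<in>I. measure lborel (K i))"

lemma box_packing_cboxE:
  assumes "box_packing I K" "i \<in> I"
  obtains a b where "K i = cbox a b"
  using assms unfolding box_packing_def by blast

lemma box_packing_volume_pos:
  assumes "box_packing I K" "i \<in> I"
  shows "measure lborel (K i) > 0"
proof -
  obtain a b where "K i = cbox a b" using box_packing_cboxE[OF assms] .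
  moreover have "interior (K i) \<noteq> {}" using assms by (simp add: box_packing_def)
  ultimately show ?thesis
    using content_eq_0_interior measure_nonneg[of lborel "K i"] by (metis less_eq_real_def)
qed

lemma packing_volume_pos: "box_packing I K \<Longrightarrow> packing_volume I K > 0"
  by (rule sum_pos) (auto simp: box_packing_def intro: box_packing_volume_pos)

lemma compact_packing:
  assumes "box_packing I K"
  shows "compact (\<Union>i\<in>I. K i)"
proof (rule compact_UN)
  show "compact (K i)" if "i \<in> I" for i
    using box_packing_cboxE[OF assms that] compact_cbox by metis
qed (use assms in \<open>simp add: box_packing_def\<close>)

lemma lmeasurable_mixture_packing:
  assumes "box_packing I K" "box_packing J L"
  shows "mixture u (\<Union>i\<in>I. K i) v (\<Union>i\<in>J. L i) \<in> lmeasurable"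
  by (intro lmeasurable_compact compact_mixture compact_packing assms)

section \<open>Brunn--Minkowski for two boxes\<close>

lemma prod_powr_mixture_le:
  fixes x y :: "'i \<Rightarrow> real"
  assumes "0 \<le> u" "0 \<le> v" "u + v = 1" "\<And>i. i \<in> I \<Longrightarrow> x i > 0" "\<And>i. i \<in> I \<Longrightarrow> y i > 0"
  shows "(\<Prod>i\<in>I. x i) powr u * (\<Prod>i\<in>I. y i) powr v \<le> (\<Prod>i\<in>I. u * x i + v * y i)"
proof -
  have "(\<Prod>i\<in>I. x i) powr u * (\<Prod>i\<in>I. y i) powr v = (\<Prod>i\<in>I. x i powr u * y i powr v)"
    using assms(4,5) by (simp add: prod_powr_distrib prod.distrib less_imp_le)
  \<comment> \<open>Young's inequality, that is, the weighted inequality of means, in each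
    factor.\<close>
  also have "\<dots> \<le> (\<Prod>i\<in>I. u * x i + v * y i)"
    using assms by (intro prod_mono) (auto intro: Youngs_inequality_0)
  finally show ?thesis .
qed

text \<open>In coordinate \<open>i\<close>, the point \<open>z\<close> divides the side of the mixed
  box, of length \<open>w i\<close>, in some ratio \<open>t i\<close>. The points \<open>x\<close>
  and \<open>y\<close> that divide the sides of the two given boxes in the same ratios mix to
  \<open>z\<close>.\<close>

lemma cbox_subset_mixture:
  fixes a b :: "'a::euclidean_space"
  assumes uv: "0 < u" "0 < v"
    and ab: "\<And>i. i \<in> Basis \<Longrightarrow> a \<bullet> i < b \<bullet> i" "\<And>i. i \<in> Basis \<Longrightarrow> a' \<bullet> i < b' \<bullet> i"
  shows "cbox (u *\<^sub>R a + v *\<^sub>R a') (u *\<^sub>R b + v *\<^sub>R b') \<subseteq> mixture u (cbox a b) v (cbox a' b')"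
proof
  fix z assume z: "z \<in> cbox (u *\<^sub>R a + v *\<^sub>R a') (u *\<^sub>R b + v *\<^sub>R b')"
  define w where "w i = u * (b \<bullet> i - a \<bullet> i) + v * (b' \<bullet> i - a' \<bullet> i)" for i
  define t where "t i = (z \<bullet> i - (u * (a \<bullet> i) + v * (a' \<bullet> i))) / w i" for i
  define x where "x = (\<Sum>i\<in>Basis. (a \<bullet> i + t i * (b \<bullet> i - a \<bullet> i)) *\<^sub>R i)"
  define y where "y = (\<Sum>i\<in>Basis. (a' \<bullet> i + t i * (b' \<bullet> i - a' \<bullet> i)) *\<^sub>R i)"
  have w: "w i > 0" if "i \<in> Basis" for i
    unfolding w_def using uv ab[OF that] by (simp add: add_pos_pos)
  have t: "0 \<le> t i \<and> t i \<le> 1" if "i \<in> Basis" for i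
    using z w[OF that] that by (auto simp: t_def mem_box inner_simps w_def field_simps)
  have tw: "t i * w i = z \<bullet> i - (u * (a \<bullet> i) + v * (a' \<bullet> i))" if "i \<in> Basis" for i
    using w[OF that] by (simp add: t_def)
  have between: "p \<le> p + s * (q - p) \<and> p + s * (q - p) \<le> q"
    if "0 \<le> s" "s \<le> 1" "p < q" for p q s :: real
    using mult_left_le_one_le[of "q - p" s] mult_nonneg_nonneg[of s "q - p"] that by linarith
  have "x \<in> cbox a b" "y \<in> cbox a' b'"
    using t ab by (auto simp: x_def y_def mem_box between[THEN conjunct2]
        intro!: mult_nonneg_nonneg intro: less_imp_le)
  moreover have "z = u *\<^sub>R x + v *\<^sub>R y"
  proof (rule euclidean_eqI)
    fix i :: 'a assume i: "i \<in> Basis"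
    have "x \<bullet> i = a \<bullet> i + t i * (b \<bullet> i - a \<bullet> i)" "y \<bullet> i = a' \<bullet> i + t i * (b' \<bullet> i - a' \<bullet> i)"
      using i by (simp_all add: x_def y_def)
    then have "(u *\<^sub>R x + v *\<^sub>R y) \<bullet> i = u * (a \<bullet> i) + v * (a' \<bullet> i) + t i * w i"
      unfolding inner_add_left inner_scaleR_left w_def by (simp only:) (simp add: algebra_simps)
    then show "z \<bullet> i = (u *\<^sub>R x + v *\<^sub>R y) \<bullet> i"
      using tw[OF i] by simp
  qed
  ultimately show "z \<in> mixture u (cbox a b) v (cbox a' b')"
    by (auto simp: mixture_def)
qed

lemma content_le_lebesgue:
  assumes "cbox a b \<subseteq> S" "S \<in> lmeasurable"
  shows "measure lborel (cbox a b) \<le> measure lebesgue S"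
  using measure_mono_fmeasurable[OF assms(1) _ assms(2)] by simp

lemma Brunn_Minkowski_cbox:
  fixes a b :: "'a::euclidean_space"
  assumes uv: "0 < u" "0 < v" "u + v = 1"
    and "interior (cbox a b) \<noteq> {}" "interior (cbox a' b') \<noteq> {}"
  shows "measure lborel (cbox a b) powr u * measure lborel (cbox a' b') powr v
           \<le> measure lebesgue (mixture u (cbox a b) v (cbox a' b'))"
proof -
  have ab: "a \<bullet> i < b \<bullet> i" "a' \<bullet> i < b' \<bullet> i" if "i \<in> Basis" for i
    using assms(4,5) that by (auto simp: box_ne_empty)
  have less: "u * (a \<bullet> i) + v * (a' \<bullet> i) < u * (b \<bullet> i) + v * (b' \<bullet> i)" if "i \<in> Basis" for i
    using ab[OF that] uv by (simp add: add_strict_mono)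
  have "measure lborel (cbox a b) powr u * measure lborel (cbox a' b') powr v
        = (\<Prod>i\<in>Basis. b \<bullet> i - a \<bullet> i) powr u * (\<Prod>i\<in>Basis. b' \<bullet> i - a' \<bullet> i) powr v"
    using ab by (simp add: content_cbox_cases less_imp_le)
  also have "\<dots> \<le> (\<Prod>i\<in>Basis. u * (b \<bullet> i - a \<bullet> i) + v * (b' \<bullet> i - a' \<bullet> i))"
    using ab uv by (intro prod_powr_mixture_le) auto
  also have "\<dots> = measure lborel (cbox (u *\<^sub>R a + v *\<^sub>R a') (u *\<^sub>R b + v *\<^sub>R b'))"
    using less by (simp add: content_cbox_cases inner_simps less_imp_le algebra_simps)
  also have "\<dots> \<le> measure lebesgue (mixture u (cbox a b) v (cbox a' b'))"
    using cbox_subset_mixture[of u v a b a' b'] ab uv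
    by (intro content_le_lebesgue lmeasurable_compact compact_mixture) auto
  finally show ?thesis .
qed

section \<open>Cutting packings by coordinate hyperplanes\<close>

lemma interior_empty_if_in_hyperplane:
  fixes S :: "'a::euclidean_space set"
  assumes "j \<in> Basis" "S \<subseteq> {x. x \<bullet> j = c}"
  shows "interior S = {}"
  using negligible_standard_hyperplane[OF assms(1), of c] assms(2)
  by (meson interior_subset negligible_subset open_interior open_not_negligible)

text \<open>Boxes that the half-space meets in a set without interior are dropped. They contribute
  volume zero, so the total is unchanged, and its positivity guarantees that some box
  remains.\<close>

lemma box_packing_Int_halfspace:
  fixes K :: "'i \<Rightarrow> 'a::euclidean_space set"
  assumes K: "box_packing I K" and j: "j \<in> Basis"
    and H: "H = {x. x \<bullet> j \<le> c} \<or> H = {x. x \<bullet> j \<ge> c}"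
    and pos: "(\<Sum>i\<in>I. measure lborel (K i \<inter> H)) > 0"
  defines "I' \<equiv> {i\<in>I. interior (K i \<inter> H) \<noteq> {}}"
  shows "box_packing I' (\<lambda>i. K i \<inter> H)"
    and "packing_volume I' (\<lambda>i. K i \<inter> H) = (\<Sum>i\<in>I. measure lborel (K i \<inter> H))"
proof -
  have box: "\<exists>a b. K i \<inter> H = cbox a b" if i: "i \<in> I" for i
  proof -
    obtain a b where "K i = cbox a b" using box_packing_cboxE[OF K i] .
    then show ?thesis using H interval_split[OF j, of a b c] by auto
  qed
  have fin: "finite I" using K by (simp add: box_packing_def)
  show *: "packing_volume I' (\<lambda>i. K i \<inter> H) = (\<Sum>i\<in>I. measure lborel (K i \<inter> H))"
  proof (rule sum.mono_neutral_left[OF fin])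
    show "\<forall>i\<in>I - I'. measure lborel (K i \<inter> H) = 0"
      using box by (auto simp: I'_def) (metis content_eq_0_interior interior_Int)
  qed (auto simp: I'_def)
  have "I' \<noteq> {}" using * pos by auto
  moreover have "disjoint_family_on (\<lambda>i. interior (K i \<inter> H)) I'"
    using K by (fastforce simp: box_packing_def disjoint_family_on_def I'_def)
  ultimately show "box_packing I' (\<lambda>i. K i \<inter> H)"
    using fin box by (auto simp: box_packing_def I'_def)
qed

lemma continuous_on_content_halfspace:
  fixes a b :: "'a::euclidean_space"
  assumes j: "j \<in> Basis"
  shows "continuous_on UNIV (\<lambda>c. measure lborel (cbox a b \<inter> {x. x \<bullet> j \<le> c}))"
proof (cases "\<forall>i\<in>Basis. a \<bullet> i \<le> b \<bullet> i")
  case True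
  \<comment> \<open>The cut affects only side \<open>j\<close>, which then ends at
    \<open>min (b \<bullet> j) c\<close>; \<open>max 0\<close> accounts for an empty intersection.
    The right-hand side is visibly continuous in \<open>c\<close>.\<close>
  have "measure lborel (cbox a b \<inter> {x. x \<bullet> j \<le> c})
         = max 0 (min (b \<bullet> j) c - a \<bullet> j) * (\<Prod>i\<in>Basis-{j}. b \<bullet> i - a \<bullet> i)" for c
  proof (cases "a \<bullet> j \<le> c")
    case ac: True
    let ?b = "\<Sum>i\<in>Basis. (if i = j then min (b \<bullet> j) c else b \<bullet> i) *\<^sub>R i"
    have "measure lborel (cbox a ?b) = (\<Prod>i\<in>Basis. ?b \<bullet> i - a \<bullet> i)"
      using True ac j by (intro content_cbox) auto
    also have "\<dots> = (min (b \<bullet> j) c - a \<bullet> j) * (\<Prod>i\<in>Basis-{j}. b \<bullet> i - a \<bullet> i)"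
      using j by (subst prod.remove[OF _ j]) (auto intro!: prod.cong)
    finally show ?thesis
      using True ac j by (simp add: interval_split[OF j])
  next
    case False
    then have "cbox a b \<inter> {x. x \<bullet> j \<le> c} = {}"
      using j by (force simp: mem_box)
    then show ?thesis using False by simp
  qed
  then show ?thesis by (simp only:) (intro continuous_intros)
next
  case False
  then have "cbox a b = {}" by (force simp: box_eq_empty)
  then show ?thesis by simp
qed

text \<open>As the hyperplane sweeps across the bounded packing, the volume cut off varies
  continuously from zero to the total, so the intermediate value theorem applies.\<close>

lemma halfspace_cutting_packing:
  fixes L :: "'i \<Rightarrow> 'a::euclidean_space set"
  assumes L: "box_packing J L" and j: "j \<in> Basis"
    and "0 \<le> m" "m \<le> packing_volume J L"
  obtains c where "(\<Sum>i\<in>J. measure lborel (L i \<inter> {x. x \<bullet> j \<le> c})) = m"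
proof -
  let ?g = "\<lambda>c. \<Sum>i\<in>J. measure lborel (L i \<inter> {x. x \<bullet> j \<le> c})"
  have cont: "continuous_on UNIV ?g"
  proof (rule continuous_on_sum)
    fix i assume "i \<in> J"
    then obtain a b where "L i = cbox a b" using box_packing_cboxE[OF L] by blast
    then show "continuous_on UNIV (\<lambda>c. measure lborel (L i \<inter> {x. x \<bullet> j \<le> c}))"
      using continuous_on_content_halfspace[OF j] by simp
  qed
  obtain M where M: "M > 0" "\<And>x. x \<in> (\<Union>i\<in>J. L i) \<Longrightarrow> norm x < M"
    using compact_imp_bounded[OF compact_packing[OF L]] bounded_pos_less by metis
  have "\<bar>x \<bullet> j\<bar> < M" if "x \<in> L i" "i \<in> J" for x i
    using Basis_le_norm[OF j, of x] M(2)[of x] that by fastforce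
  then have "L i \<inter> {x. x \<bullet> j \<le> - M} = {}" "L i \<inter> {x. x \<bullet> j \<le> M} = L i" if "i \<in> J" for i
    using that by force+
  then have "?g (- M) = 0" "?g M = packing_volume J L" by (simp_all)
  then obtain c where "?g c = m"
    using IVT'[of ?g "- M" m M] assms(3,4) M(1) continuous_on_subset[OF cont] by auto
  then show thesis by (rule that)
qed

lemma packing_volume_split:
  fixes K :: "'i \<Rightarrow> 'a::euclidean_space set"
  assumes K: "box_packing I K" and j: "j \<in> Basis"
  shows "packing_volume I K
    = (\<Sum>i\<in>I. measure lborel (K i \<inter> {x. x \<bullet> j \<le> c})) + (\<Sum>i\<in>I. measure lborel (K i \<inter> {x. x \<bullet> j \<ge> c}))"
  unfolding sum.distrib[symmetric]
proof (rule sum.cong[OF refl])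
  fix i assume "i \<in> I"
  then obtain a b where "K i = cbox a b" using box_packing_cboxE[OF K] by blast
  then show "measure lborel (K i) = measure lborel (K i \<inter> {x. x \<bullet> j \<le> c}) + measure lborel (K i \<inter> {x. x \<bullet> j \<ge> c})"
    using content_split[OF j] by metis
qed

text \<open>Open boxes are products of intervals, so nonempty ones are disjoint only if their
  intervals in some coordinate \<open>j\<close> are. The two cases tell which box comes
  first.\<close>

lemma interior_disjoint_cboxes_separated:
  fixes K L :: "'a::euclidean_space set"
  assumes "K = cbox a b" "L = cbox a' b'" "interior K \<noteq> {}" "interior L \<noteq> {}"
    and "interior K \<inter> interior L = {}"
  obtains j c where "j \<in> Basis" "K \<subseteq> {x. x \<bullet> j \<le> c}" "L \<subseteq> {x. x \<bullet> j \<ge> c}"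
  | j c where "j \<in> Basis" "L \<subseteq> {x. x \<bullet> j \<le> c}" "K \<subseteq> {x. x \<bullet> j \<ge> c}"
proof -
  have "box a b \<inter> box a' b' = {}" "\<forall>i\<in>Basis. a \<bullet> i < b \<bullet> i" "\<forall>i\<in>Basis. a' \<bullet> i < b' \<bullet> i"
    using assms by (auto simp: box_ne_empty)
  then obtain j where j: "j \<in> Basis" "b \<bullet> j \<le> a' \<bullet> j \<or> b' \<bullet> j \<le> a \<bullet> j"
    unfolding disjoint_interval by (meson not_le)
  then show thesis
  proof (elim disjE)
    assume "b \<bullet> j \<le> a' \<bullet> j"
    then show thesis using j(1) assms(1,2) by (intro that(1)[of j "b \<bullet> j"]) (force simp: mem_box)+
  next
    assume "b' \<bullet> j \<le> a \<bullet> j"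
    then show thesis using j(1) assms(1,2) by (intro that(2)[of j "b' \<bullet> j"]) (force simp: mem_box)+
  qed
qed

section \<open>Brunn--Minkowski for packings of boxes\<close>

lemma powr_scale_both:
  fixes A B t u v :: real
  assumes "0 \<le> t" "u + v = 1" "0 \<le> A" "0 \<le> B"
  shows "(t * A) powr u * (t * B) powr v = t * (A powr u * B powr v)"
proof -
  have "(t * A) powr u * (t * B) powr v = (t powr u * t powr v) * (A powr u * B powr v)"
    using assms by (simp add: powr_mult)
  also have "t powr u * t powr v = t"
    using assms by (simp flip: powr_add)
  finally show ?thesis .
qed

text \<open>The Hadwiger--Ohmann cut: a hyperplane separating two boxes of \<open>K\<close> and a
  parallel one cutting \<open>L\<close> in the same volume ratio leave two pairs with fewer boxes.
  The induction hypothesis is an assumption so that the step also serves with the two packings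
  exchanged.\<close>

lemma Brunn_Minkowski_packing_step:
  fixes K L :: "'i \<Rightarrow> 'a::euclidean_space set"
  assumes uv: "0 < u" "0 < v" "u + v = 1"
    and K: "box_packing I K" and L: "box_packing J L" and two: "card I \<ge> 2"
    and IH: "\<And>I' K' J' L'. box_packing I' K' \<Longrightarrow> box_packing J' L' \<Longrightarrow>
        card I' + card J' < card I + card J \<Longrightarrow>
        packing_volume I' (K' :: 'i \<Rightarrow> 'a set) powr u * packing_volume J' (L' :: 'i \<Rightarrow> 'a set) powr v
          \<le> measure lebesgue (mixture u (\<Union>i\<in>I'. K' i) v (\<Union>i\<in>J'. L' i))"
  shows "packing_volume I K powr u * packing_volume J L powr v
          \<le> measure lebesgue (mixture u (\<Union>i\<in>I. K i) v (\<Union>i\<in>J. L i))"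
proof -
  have finI: "finite I" and finJ: "finite J" using K L by (auto simp: box_packing_def)
  \<comment> \<open>Calling the lower box \<open>p\<close> and the upper one \<open>q\<close> merges
    the two cases of the separation.\<close>
  obtain p q j c where pq: "p \<in> I" "q \<in> I" and j: "j \<in> Basis"
    and pc: "K p \<subseteq> {x. x \<bullet> j \<le> c}" and qc: "K q \<subseteq> {x. x \<bullet> j \<ge> c}"
  proof -
    obtain p q where pq: "p \<in> I" "q \<in> I" "p \<noteq> q"
      using two by (metis One_nat_def Suc_1 card_le_Suc0_iff_eq finI not_less_eq_eq)
    obtain a b a' b' where "K p = cbox a b" "K q = cbox a' b'"
      using K pq by (meson box_packing_def)
    moreover have "interior (K p) \<noteq> {}" "interior (K q) \<noteq> {}" "interior (K p) \<inter> interior (K q) = {}"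
      using K pq by (auto simp: box_packing_def disjoint_family_on_def)
    ultimately show thesis
      by (rule interior_disjoint_cboxes_separated) (use pq that in blast)+
  qed
  define lo where "lo c = {x. x \<bullet> j \<le> c}" for c
  define hi where "hi c = {x. x \<bullet> j \<ge> c}" for c
  let ?A = "packing_volume I K" and ?B = "packing_volume J L"
  define A1 where "A1 = (\<Sum>i\<in>I. measure lborel (K i \<inter> lo c))"
  define A2 where "A2 = (\<Sum>i\<in>I. measure lborel (K i \<inter> hi c))"
  have A: "?A = A1 + A2"
    unfolding A1_def A2_def lo_def hi_def by (rule packing_volume_split[OF K j])
  have Apos: "?A > 0" and Bpos: "?B > 0" using packing_volume_pos K L by auto
  have "K p \<inter> lo c = K p" "K q \<inter> hi c = K q"
    using pc qc by (auto simp: lo_def hi_def)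
  then have A1pos: "A1 > 0" and A2pos: "A2 > 0"
    unfolding A1_def A2_def using box_packing_volume_pos[OF K] pq
      sum_pos2[OF finI, of p "\<lambda>i. measure lborel (K i \<inter> lo c)"]
      sum_pos2[OF finI, of q "\<lambda>i. measure lborel (K i \<inter> hi c)"] by simp_all
  define t where "t = A1 / ?A"
  have t: "0 < t" "t < 1" "A1 = t * ?A" "A2 = (1 - t) * ?A"
    using A1pos A2pos A Apos by (auto simp: t_def field_simps)
  \<comment> \<open>With the same ratio \<open>t\<close> for both packings, the bound for the lower
    pair is \<open>t\<close> times the full bound, and for the upper pair \<open>1 - t\<close> times
    it, because the exponents add up to one.\<close>
  obtain d where d: "(\<Sum>i\<in>J. measure lborel (L i \<inter> lo d)) = t * ?B"
    using halfspace_cutting_packing[OF L j, of "t * ?B"] t Bpos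
    unfolding lo_def by auto
  have d': "(\<Sum>i\<in>J. measure lborel (L i \<inter> hi d)) = (1 - t) * ?B"
    using packing_volume_split[OF L j, of d] d by (simp add: lo_def hi_def algebra_simps)
  define I1 where "I1 = {i\<in>I. interior (K i \<inter> lo c) \<noteq> {}}"
  define I2 where "I2 = {i\<in>I. interior (K i \<inter> hi c) \<noteq> {}}"
  define J1 where "J1 = {i\<in>J. interior (L i \<inter> lo d) \<noteq> {}}"
  define J2 where "J2 = {i\<in>J. interior (L i \<inter> hi d) \<noteq> {}}"
  note half = box_packing_Int_halfspace[OF _ j]
  have I1: "box_packing I1 (\<lambda>i. K i \<inter> lo c)" "packing_volume I1 (\<lambda>i. K i \<inter> lo c) = t * ?A"
    using half[OF K, of "lo c" c] A1pos t by (auto simp: lo_def I1_def A1_def)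
  have I2: "box_packing I2 (\<lambda>i. K i \<inter> hi c)" "packing_volume I2 (\<lambda>i. K i \<inter> hi c) = (1 - t) * ?A"
    using half[OF K, of "hi c" c] A2pos t by (auto simp: hi_def I2_def A2_def)
  have J1: "box_packing J1 (\<lambda>i. L i \<inter> lo d)" "packing_volume J1 (\<lambda>i. L i \<inter> lo d) = t * ?B"
    using half[OF L, of "lo d" d] t Bpos d by (auto simp: lo_def J1_def)
  have J2: "box_packing J2 (\<lambda>i. L i \<inter> hi d)" "packing_volume J2 (\<lambda>i. L i \<inter> hi d) = (1 - t) * ?B"
    using half[OF L, of "hi d" d] t Bpos d' by (auto simp: hi_def J2_def)
  \<comment> \<open>\<open>K q\<close> meets the lower half-space only inside the hyperplane, so
    \<open>q\<close> drops out of \<open>I1\<close>; likewise \<open>p\<close> drops out of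
    \<open>I2\<close>. The number of boxes of \<open>L\<close> on either side does not exceed
    \<open>card J\<close>.\<close>
  have "interior (K q \<inter> lo c) = {}" "interior (K p \<inter> hi c) = {}"
    using pc qc by (auto intro!: interior_empty_if_in_hyperplane[OF j, of _ c] simp: lo_def hi_def
        simp del: interior_Int)
  then have "I1 \<subset> I" "I2 \<subset> I"
    using pq by (auto simp: I1_def I2_def)
  then have "card I1 < card I" "card I2 < card I"
    using finI psubset_card_mono by blast+
  moreover have "card J1 \<le> card J" "card J2 \<le> card J"
    using finJ by (auto intro!: card_mono simp: J1_def J2_def)
  ultimately have card: "card I1 + card J1 < card I + card J" "card I2 + card J2 < card I + card J"
    by linarith+
  let ?M1 = "mixture u (\<Union>i\<in>I1. K i \<inter> lo c) v (\<Union>i\<in>J1. L i \<inter> lo d)"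
  let ?M2 = "mixture u (\<Union>i\<in>I2. K i \<inter> hi c) v (\<Union>i\<in>J2. L i \<inter> hi d)"
  let ?M = "mixture u (\<Union>i\<in>I. K i) v (\<Union>i\<in>J. L i)"
  have meas: "?M1 \<in> lmeasurable" "?M2 \<in> lmeasurable" "?M \<in> lmeasurable"
    by (rule lmeasurable_mixture_packing[OF I1(1) J1(1)] lmeasurable_mixture_packing[OF I2(1) J2(1)]
        lmeasurable_mixture_packing[OF K L])+
  have "?A powr u * ?B powr v = t * (?A powr u * ?B powr v) + (1 - t) * (?A powr u * ?B powr v)"
    by (simp add: algebra_simps)
  also have "\<dots> = (t * ?A) powr u * (t * ?B) powr v + ((1 - t) * ?A) powr u * ((1 - t) * ?B) powr v"
    using t uv Apos Bpos by (simp add: powr_scale_both)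
  also have "\<dots> \<le> measure lebesgue ?M1 + measure lebesgue ?M2"
    using IH[OF I1(1) J1(1) card(1)] IH[OF I2(1) J2(1) card(2)] I1 I2 J1 J2 by (intro add_mono) simp_all
  also have "\<dots> = measure lebesgue (?M1 \<union> ?M2)"
  proof -
    \<comment> \<open>The two mixtures lie on opposite sides of the hyperplane at the mixed level
      \<open>u * c + v * d\<close>, so they overlap in a null set and their volumes add.\<close>
    have "?M1 \<subseteq> {x. x \<bullet> j \<le> u * c + v * d}"
      using uv by (auto simp: mixture_def lo_def inner_simps intro!: add_mono mult_left_mono)
    moreover have "?M2 \<subseteq> {x. x \<bullet> j \<ge> u * c + v * d}"
      using uv by (auto simp: mixture_def hi_def inner_simps intro!: add_mono mult_left_mono)
    ultimately have "?M1 \<inter> ?M2 \<subseteq> {x. x \<bullet> j = u * c + v * d}" by fastforce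
    then have "negligible (?M1 \<inter> ?M2)"
      using negligible_standard_hyperplane[OF j] negligible_subset by blast
    then have "measure lebesgue (?M1 \<inter> ?M2) = 0"
      by (rule negligible_imp_measure0)
    then show ?thesis using measure_Un3[OF meas(1,2)] by simp
  qed
  also have "\<dots> \<le> measure lebesgue ?M"
  proof (rule measure_mono_fmeasurable)
    show "?M1 \<union> ?M2 \<subseteq> ?M"
      by (intro Un_least mixture_mono) (auto simp: I1_def I2_def J1_def J2_def)
  qed (use meas in auto)
  finally show ?thesis .
qed

text \<open>Induction on the total number of boxes: a packing with at least two boxes is cut, and
  two single boxes are the base case. The weights are generalised because exchanging the packings
  exchanges \<open>u\<close> and \<open>v\<close>.\<close>

lemma Brunn_Minkowski_packing:
  fixes K L :: "'i \<Rightarrow> 'a::euclidean_space set"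
  assumes "0 < u" "0 < v" "u + v = 1" "box_packing I K" "box_packing J L"
  shows "packing_volume I K powr u * packing_volume J L powr v
          \<le> measure lebesgue (mixture u (\<Union>i\<in>I. K i) v (\<Union>i\<in>J. L i))"
  using assms
proof (induction "card I + card J" arbitrary: I K J L u v rule: less_induct)
  case less
  note uv = less.prems(1-3)
  consider "card I \<ge> 2" | "card J \<ge> 2" | "card I = 1" "card J = 1"
  proof -
    have "card I \<noteq> 0" "card J \<noteq> 0"
      using less.prems(4,5) by (auto simp: box_packing_def)
    then show thesis using that by linarith
  qed
  then show ?case
  proof cases
    case 1
    show ?thesis
    proof (rule Brunn_Minkowski_packing_step[OF uv less.prems(4,5) 1])
      fix I' J' :: "'i set" and K' L' :: "'i \<Rightarrow> 'a set"
      assume *: "box_packing I' K'" "box_packing J' L'" "card I' + card J' < card I + card J"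
      show "packing_volume I' K' powr u * packing_volume J' L' powr v
          \<le> measure lebesgue (mixture u (\<Union>i\<in>I'. K' i) v (\<Union>i\<in>J'. L' i))"
        using less.hyps[OF *(3) uv *(1,2)] .
    qed
  next
    case 2
    have "packing_volume J L powr v * packing_volume I K powr u
          \<le> measure lebesgue (mixture v (\<Union>i\<in>J. L i) u (\<Union>i\<in>I. K i))"
    proof (rule Brunn_Minkowski_packing_step[OF uv(2,1) _ less.prems(5,4) 2])
      fix I' J' :: "'i set" and K' L' :: "'i \<Rightarrow> 'a set"
      assume *: "box_packing I' K'" "box_packing J' L'" "card I' + card J' < card J + card I"
      show "packing_volume I' K' powr v * packing_volume J' L' powr u
          \<le> measure lebesgue (mixture v (\<Union>i\<in>I'. K' i) u (\<Union>i\<in>J'. L' i))"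
        using less.hyps[OF _ uv(2,1) _ *(1,2)] *(3) uv(3) by (simp add: add.commute)
    qed (use uv in auto)
    then show ?thesis by (simp add: mult.commute mixture_commute)
  next
    case 3
    then obtain i l where "I = {i}" "J = {l}" by (auto simp: card_1_singleton_iff)
    moreover from this obtain a b a' b' where "K i = cbox a b" "L l = cbox a' b'"
      using less.prems(4,5) by (auto simp: box_packing_def)
    moreover have "interior (K i) \<noteq> {}" "interior (L l) \<noteq> {}"
      using less.prems(4,5) calculation by (auto simp: box_packing_def)
    ultimately show ?thesis
      using Brunn_Minkowski_cbox[OF uv, of a b a' b'] by simp
  qed
qed

section \<open>From packings to bounded convex sets\<close>

lemma open_inner_box_packing:
  fixes U :: "'a::euclidean_space set"
  assumes "open U" "U \<in> lmeasurable" "0 \<le> m" "m < measure lebesgue U"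
  obtains P where "box_packing P (\<lambda>K. K)" "\<Union>P \<subseteq> U" "m < packing_volume P (\<lambda>K. K)"
proof -
  obtain D where D: "countable D" "D \<subseteq> Pow U" "\<And>X. X \<in> D \<Longrightarrow> \<exists>a b. X = cbox a b" "\<Union>D = U"
    using open_countable_Union_open_cbox[OF assms(1)] by metis
  \<comment> \<open>\<open>U\<close> has positive volume, so it is nonempty; hence
    \<open>from_nat_into D\<close> really enumerates \<open>D\<close>.\<close>
  have "D \<noteq> {}" using D(4) assms(3,4) by auto
  \<comment> \<open>Finite unions of the boxes increase to \<open>U\<close>, so their volumes
    eventually exceed \<open>m\<close>; each such union can be divided into boxes with disjoint
    interiors.\<close>
  define S where "S n = \<Union>(from_nat_into D ` {..n})" for n
  have box: "\<exists>a b. X = cbox a b" if "X \<in> from_nat_into D ` {..n}" for X n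
    using that D(3) from_nat_into[OF \<open>D \<noteq> {}\<close>] by auto
  have "\<exists>p. p division_of S n" for n
    unfolding S_def
    by (rule elementary_unions_intervals[of "from_nat_into D ` {..n}"]) (use box in blast)+
  then obtain p where p: "\<And>n. p n division_of S n" by metis
  have meas: "S n \<in> lmeasurable" for n using p lmeasurable_division by blast
  have SU: "S n \<subseteq> U" for n
    using D(2) from_nat_into[OF \<open>D \<noteq> {}\<close>] by (force simp: S_def)
  have "(\<lambda>n. measure lebesgue (S n)) \<longlonglongrightarrow> measure lebesgue (\<Union>n. S n)"
  proof (rule measure_nested_Union[OF meas])
    show "measure lebesgue (S n) \<le> measure lebesgue U" for n
      using measure_mono_fmeasurable[OF SU _ assms(2)] meas by blast
    show "S n \<subseteq> S (Suc n)" for n unfolding S_def by (intro Union_mono image_mono) auto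
  qed
  moreover have "(\<Union>n. S n) = U"
    using D(4) SU from_nat_into_surj[OF D(1)] by (fastforce simp: S_def)
  ultimately have "eventually (\<lambda>n. m < measure lebesgue (S n)) sequentially"
    using assms(4) by (auto dest: order_tendstoD(1))
  then obtain n where n: "m < measure lebesgue (S n)"
    by (auto simp: eventually_sequentially)
  \<comment> \<open>A division may contain flat boxes; discarding them costs no volume.\<close>
  define P where "P = {K \<in> p n. interior K \<noteq> {}}"
  note div = division_ofD[OF p[of n]]
  have "measure lborel K = measure lebesgue K" if "K \<in> p n" for K
    using div(4)[OF that] by auto
  then have "measure lebesgue (S n) = (\<Sum>K\<in>p n. measure lborel K)"
    using content_division[OF p[of n]] by simp
  also have "\<dots> = packing_volume P (\<lambda>K. K)"
  proof (rule sum.mono_neutral_right[OF div(1)])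
    show "\<forall>K\<in>p n - P. measure lborel K = 0"
      using div(4) by (auto simp: P_def) (metis content_eq_0_interior)
  qed (auto simp: P_def)
  finally have vol: "m < packing_volume P (\<lambda>K. K)" using n by simp
  then have "P \<noteq> {}" using assms(3) by auto
  then have "box_packing P (\<lambda>K. K)"
    using div(1,4,5) by (auto simp: box_packing_def P_def disjoint_family_on_def)
  moreover have "\<Union>P \<subseteq> U" using SU div(6) by (auto simp: P_def)
  ultimately show thesis using vol that by blast
qed

text \<open>Both sets are exhausted from inside by packings, to which the inequality for boxes
  applies. Bounding the volume of a measurable superset \<open>W\<close> avoids the question whether
  the mixture itself is measurable.\<close>

lemma measure_mixture_ge:
  fixes A B W :: "'a::euclidean_space set"
  assumes uv: "0 < u" "0 < v" "u + v = 1"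
    and A: "convex A" "bounded A" "m \<le> measure lebesgue A"
    and B: "convex B" "bounded B" "m \<le> measure lebesgue B"
    and W: "mixture u A v B \<subseteq> W" "W \<in> lmeasurable"
  shows "m \<le> measure lebesgue W"
proof (rule dense_le)
  fix m' assume "m' < m"
  show "m' \<le> measure lebesgue W"
  proof (cases "m' > 0")
    case False
    then show ?thesis using measure_nonneg[of lebesgue W] by linarith
  next
    case True
    have inner: "\<exists>P. box_packing P (\<lambda>K. K) \<and> \<Union>P \<subseteq> S \<and> m' < packing_volume P (\<lambda>K. K)"
      if "convex S" "bounded S" "m \<le> measure lebesgue S" for S :: "'a set"
    proof -
      \<comment> \<open>The frontier of a convex set is negligible, so passing to the interior keeps
        the volume.\<close>
      have "m' < measure lebesgue (interior S)"
        using measure_interior[OF that(2) negligible_convex_frontier[OF that(1)]] that(3) \<open>m' < m\<close>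
        by simp
      then show ?thesis
        using open_inner_box_packing[OF open_interior lmeasurable_interior[OF that(2)], of m']
          True interior_subset[of S] by (metis less_imp_le subset_trans)
    qed
    obtain P Q where P: "box_packing P (\<lambda>K. K)" "\<Union>P \<subseteq> A" "m' < packing_volume P (\<lambda>K. K)"
      and Q: "box_packing Q (\<lambda>K. K)" "\<Union>Q \<subseteq> B" "m' < packing_volume Q (\<lambda>K. K)"
      using inner[OF A] inner[OF B] by blast
    have "m' = m' powr u * m' powr v"
      using True uv by (simp flip: powr_add)
    also have "\<dots> \<le> packing_volume P (\<lambda>K. K) powr u * packing_volume Q (\<lambda>K. K) powr v"
      using P(3) Q(3) True uv by (intro mult_mono powr_mono2) auto
    also have "\<dots> \<le> measure lebesgue (mixture u (\<Union>P) v (\<Union>Q))"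
      using Brunn_Minkowski_packing[OF uv P(1) Q(1)] by simp
    also have "\<dots> \<le> measure lebesgue W"
    proof (rule measure_mono_fmeasurable[OF _ _ W(2)])
      show "mixture u (\<Union>P) v (\<Union>Q) \<subseteq> W"
        using mixture_mono[OF P(2) Q(2)] W(1) by blast
      show "mixture u (\<Union>P) v (\<Union>Q) \<in> sets lebesgue"
        using lmeasurable_mixture_packing[OF P(1) Q(1)] by auto
    qed
    finally show ?thesis .
  qed
qed

subsection \<open>Zonotopes\<close>

text \<open>The sum of segments in terms of coefficients, which makes its dependence on the
  parameters explicit; \<open>zonotope_eq_Minkowski_sum\<close> gives the link. A negative side
  length makes the set empty.\<close>

definition zonotope :: "'i set \<Rightarrow> ('i \<Rightarrow> 'a::real_vector) \<Rightarrow> 'a \<Rightarrow> ('i \<Rightarrow> real) \<Rightarrow> 'a set" where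
  "zonotope I w p \<alpha> = {p + (\<Sum>i\<in>I. c i *\<^sub>R w i) | c. \<forall>i\<in>I. 0 \<le> c i \<and> c i \<le> \<alpha> i}"

lemma zonotopeI:
  "(\<And>i. i \<in> I \<Longrightarrow> 0 \<le> c i \<and> c i \<le> \<alpha> i) \<Longrightarrow> p + (\<Sum>i\<in>I. c i *\<^sub>R w i) \<in> zonotope I w p \<alpha>"
  by (auto simp: zonotope_def)

lemma closed_segment_0_scaleR:
  fixes x :: "'a::real_vector"
  assumes "0 \<le> r"
  shows "closed_segment 0 (r *\<^sub>R x) = {c *\<^sub>R x | c. 0 \<le> c \<and> c \<le> r}"
proof (intro equalityI subsetI)
  fix y assume "y \<in> closed_segment 0 (r *\<^sub>R x)"
  then obtain t where "0 \<le> t" "t \<le> 1" "y = (t * r) *\<^sub>R x"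
    by (auto simp: in_segment)
  then show "y \<in> {c *\<^sub>R x | c. 0 \<le> c \<and> c \<le> r}"
    using assms mult_left_le_one_le[of r t] by fastforce
next
  fix y assume "y \<in> {c *\<^sub>R x | c. 0 \<le> c \<and> c \<le> r}"
  then obtain c where c: "0 \<le> c" "c \<le> r" "y = c *\<^sub>R x" by blast
  show "y \<in> closed_segment 0 (r *\<^sub>R x)"
  proof (cases "r = 0")
    case False
    then have "y = (c / r) *\<^sub>R r *\<^sub>R x" "0 \<le> c / r" "c / r \<le> 1"
      using c assms by auto
    then show ?thesis by (auto simp: in_segment)
  qed (use c in auto)
qed

lemma zonotope_eq_Minkowski_sum:
  assumes "finite I" "\<And>i. i \<in> I \<Longrightarrow> 0 \<le> \<alpha> i"
  shows "zonotope I w p \<alpha> = (+) p ` (\<Sum>i\<in>I. closed_segment 0 (\<alpha> i *\<^sub>R w i))"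
proof -
  have "(\<Sum>i\<in>I. closed_segment 0 (\<alpha> i *\<^sub>R w i))
      = {sum s I | s. \<forall>i\<in>I. \<exists>c. s i = c *\<^sub>R w i \<and> 0 \<le> c \<and> c \<le> \<alpha> i}"
    using assms by (simp add: set_sum_alt closed_segment_0_scaleR)
  also have "\<dots> = {(\<Sum>i\<in>I. c i *\<^sub>R w i) | c. \<forall>i\<in>I. 0 \<le> c i \<and> c i \<le> \<alpha> i}"
  proof (intro equalityI subsetI)
    fix x assume "x \<in> {sum s I | s. \<forall>i\<in>I. \<exists>c. s i = c *\<^sub>R w i \<and> 0 \<le> c \<and> c \<le> \<alpha> i}"
    then obtain s where s: "x = sum s I" "\<forall>i\<in>I. \<exists>c. s i = c *\<^sub>R w i \<and> 0 \<le> c \<and> c \<le> \<alpha> i"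
      by blast
    from bchoice[OF s(2)] obtain c where
      "\<forall>i\<in>I. s i = c i *\<^sub>R w i \<and> 0 \<le> c i \<and> c i \<le> \<alpha> i" ..
    then show "x \<in> {(\<Sum>i\<in>I. c i *\<^sub>R w i) | c. \<forall>i\<in>I. 0 \<le> c i \<and> c i \<le> \<alpha> i}"
      using s(1) by (auto intro!: exI[of _ c] sum.cong)
  qed blast
  finally show ?thesis by (auto simp: zonotope_def)
qed

lemma zonotope_cong: "(\<And>i. i \<in> I \<Longrightarrow> \<alpha> i = \<beta> i) \<Longrightarrow> zonotope I w p \<alpha> = zonotope I w p \<beta>"
  by (simp add: zonotope_def)

lemma zonotope_mono:
  "(\<And>i. i \<in> I \<Longrightarrow> \<alpha> i \<le> \<beta> i) \<Longrightarrow> zonotope I w p \<alpha> \<subseteq> zonotope I w p \<beta>"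
  unfolding zonotope_def by (blast intro: order_trans)

text \<open>This is what turns Brunn--Minkowski into a convexity statement about parameters: mixing
  two zonotopes mixes their base points and side lengths.\<close>

lemma mixture_zonotope:
  assumes "0 \<le> u" "0 \<le> v" "\<And>i. i \<in> I \<Longrightarrow> 0 \<le> \<alpha> i" "\<And>i. i \<in> I \<Longrightarrow> 0 \<le> \<beta> i"
  shows "mixture u (zonotope I w p \<alpha>) v (zonotope I w q \<beta>)
    = zonotope I w (u *\<^sub>R p + v *\<^sub>R q) (\<lambda>i. u * \<alpha> i + v * \<beta> i)"
proof -
  have comb: "u *\<^sub>R (p + (\<Sum>i\<in>I. c i *\<^sub>R w i)) + v *\<^sub>R (q + (\<Sum>i\<in>I. d i *\<^sub>R w i))
      = u *\<^sub>R p + v *\<^sub>R q + (\<Sum>i\<in>I. (u * c i + v * d i) *\<^sub>R w i)" for c d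
    by (simp add: scaleR_add_right scaleR_add_left scaleR_sum_right sum.distrib)
  show ?thesis
  proof (intro equalityI subsetI)
    fix z assume "z \<in> mixture u (zonotope I w p \<alpha>) v (zonotope I w q \<beta>)"
    then obtain c d where cd: "\<forall>i\<in>I. 0 \<le> c i \<and> c i \<le> \<alpha> i" "\<forall>i\<in>I. 0 \<le> d i \<and> d i \<le> \<beta> i"
        "z = u *\<^sub>R (p + (\<Sum>i\<in>I. c i *\<^sub>R w i)) + v *\<^sub>R (q + (\<Sum>i\<in>I. d i *\<^sub>R w i))"
      by (auto simp: mixture_def zonotope_def)
    have "\<forall>i\<in>I. 0 \<le> u * c i + v * d i \<and> u * c i + v * d i \<le> u * \<alpha> i + v * \<beta> i"
      using cd(1,2) assms(1,2) by (auto intro!: add_mono mult_left_mono)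
    then show "z \<in> zonotope I w (u *\<^sub>R p + v *\<^sub>R q) (\<lambda>i. u * \<alpha> i + v * \<beta> i)"
      unfolding cd(3) comb by (intro zonotopeI) auto
  next
    fix z assume "z \<in> zonotope I w (u *\<^sub>R p + v *\<^sub>R q) (\<lambda>i. u * \<alpha> i + v * \<beta> i)"
    then obtain c where c: "\<And>i. i \<in> I \<Longrightarrow> 0 \<le> c i \<and> c i \<le> u * \<alpha> i + v * \<beta> i"
        "z = u *\<^sub>R p + v *\<^sub>R q + (\<Sum>i\<in>I. c i *\<^sub>R w i)"
      by (auto simp: zonotope_def)
    \<comment> \<open>The fraction of the mixed side that \<open>z\<close> uses in direction
      \<open>i\<close>; the same fraction is used in both zonotopes. If the mixed side has length
      zero, then \<open>c i = 0\<close> and \<open>t i = 0\<close> by division by zero.\<close>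
    define t where "t i = c i / (u * \<alpha> i + v * \<beta> i)" for i
    have t: "0 \<le> t i" "t i \<le> 1" "c i = u * (t i * \<alpha> i) + v * (t i * \<beta> i)" if "i \<in> I" for i
    proof -
      have "0 \<le> t i \<and> t i \<le> 1 \<and> c i = t i * (u * \<alpha> i + v * \<beta> i)"
        using c(1)[OF that] by (cases "u * \<alpha> i + v * \<beta> i = 0") (auto simp: t_def divide_le_eq_1)
      then show "0 \<le> t i" "t i \<le> 1" "c i = u * (t i * \<alpha> i) + v * (t i * \<beta> i)"
        by (auto simp: algebra_simps)
    qed
    have "(\<Sum>i\<in>I. c i *\<^sub>R w i) = (\<Sum>i\<in>I. (u * (t i * \<alpha> i) + v * (t i * \<beta> i)) *\<^sub>R w i)"
      using t(3) by (intro sum.cong) auto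
    then have "z = u *\<^sub>R (p + (\<Sum>i\<in>I. (t i * \<alpha> i) *\<^sub>R w i)) + v *\<^sub>R (q + (\<Sum>i\<in>I. (t i * \<beta> i) *\<^sub>R w i))"
      unfolding comb c(2) by simp
    moreover have "p + (\<Sum>i\<in>I. (t i * \<alpha> i) *\<^sub>R w i) \<in> zonotope I w p \<alpha>"
      "q + (\<Sum>i\<in>I. (t i * \<beta> i) *\<^sub>R w i) \<in> zonotope I w q \<beta>"
      using t(1,2) assms(3,4) by (auto intro!: zonotopeI mult_left_le_one_le)
    ultimately show "z \<in> mixture u (zonotope I w p \<alpha>) v (zonotope I w q \<beta>)"
      unfolding mixture_def by blast
  qed
qed

text \<open>A zonotope mixed with itself has unchanged parameters, hence is the same set.\<close>

lemma convex_zonotope: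
  assumes "\<And>i. i \<in> I \<Longrightarrow> 0 \<le> \<alpha> i"
  shows "convex (zonotope I w p \<alpha>)"
proof (rule convexI)
  fix x y u v assume *: "x \<in> zonotope I w p \<alpha>" "y \<in> zonotope I w p \<alpha>" "0 \<le> u" "0 \<le> v" "u + v = (1::real)"
  have "u *\<^sub>R p + v *\<^sub>R p = p" "\<And>i. u * \<alpha> i + v * \<alpha> i = \<alpha> i"
    using *(5) by (simp_all flip: scaleR_add_left distrib_right)
  then have "mixture u (zonotope I w p \<alpha>) v (zonotope I w p \<alpha>) = zonotope I w p \<alpha>"
    using mixture_zonotope[of u v I \<alpha> \<alpha> w p p] *(3,4) assms by simp
  then show "u *\<^sub>R x + v *\<^sub>R y \<in> zonotope I w p \<alpha>"
    using *(1,2) by (auto simp: mixture_def)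
qed

lemma bounded_zonotope:
  fixes w :: "'i \<Rightarrow> 'a::real_normed_vector"
  shows "bounded (zonotope I w p \<alpha>)"
proof (rule boundedI)
  fix x assume "x \<in> zonotope I w p \<alpha>"
  then obtain c where c: "x = p + (\<Sum>i\<in>I. c i *\<^sub>R w i)" "\<And>i. i \<in> I \<Longrightarrow> 0 \<le> c i \<and> c i \<le> \<alpha> i"
    by (auto simp: zonotope_def)
  have "norm (\<Sum>i\<in>I. c i *\<^sub>R w i) \<le> (\<Sum>i\<in>I. \<alpha> i * norm (w i))"
    using c(2) by (intro sum_norm_le) (simp add: mult_right_mono)
  then show "norm x \<le> norm p + (\<Sum>i\<in>I. \<alpha> i * norm (w i))"
    unfolding c(1) by (rule norm_triangle_mono[OF order_refl])
qed

text \<open>Scaling all side lengths by \<open>r\<close> is the homothety with centre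
  \<open>p\<close> and ratio \<open>r\<close>.\<close>

lemma measure_zonotope_scaled:
  fixes w :: "'i \<Rightarrow> 'a::euclidean_space"
  assumes "0 < r"
  shows "measure lebesgue (zonotope I w p (\<lambda>i. r * \<alpha> i)) = r ^ DIM('a) * measure lebesgue (zonotope I w p \<alpha>)"
proof -
  have "zonotope I w p (\<lambda>i. r * \<alpha> i) = (\<lambda>x. r *\<^sub>R x + (p - r *\<^sub>R p)) ` zonotope I w p \<alpha>"
  proof (intro equalityI subsetI)
    fix x assume "x \<in> zonotope I w p (\<lambda>i. r * \<alpha> i)"
    then obtain c where c: "x = p + (\<Sum>i\<in>I. c i *\<^sub>R w i)" "\<forall>i\<in>I. 0 \<le> c i \<and> c i \<le> r * \<alpha> i"
      by (auto simp: zonotope_def)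
    let ?y = "p + (\<Sum>i\<in>I. (c i / r) *\<^sub>R w i)"
    have "x = r *\<^sub>R ?y + (p - r *\<^sub>R p)"
      using assms by (simp add: c(1) scaleR_add_right scaleR_sum_right)
    moreover have "?y \<in> zonotope I w p \<alpha>"
      using c(2) assms by (intro zonotopeI) (auto simp: field_simps)
    ultimately show "x \<in> (\<lambda>x. r *\<^sub>R x + (p - r *\<^sub>R p)) ` zonotope I w p \<alpha>" by blast
  next
    fix x assume "x \<in> (\<lambda>x. r *\<^sub>R x + (p - r *\<^sub>R p)) ` zonotope I w p \<alpha>"
    then obtain c where c: "x = r *\<^sub>R (p + (\<Sum>i\<in>I. c i *\<^sub>R w i)) + (p - r *\<^sub>R p)"
        "\<forall>i\<in>I. 0 \<le> c i \<and> c i \<le> \<alpha> i"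
      by (auto simp: zonotope_def)
    have "x = p + (\<Sum>i\<in>I. (r * c i) *\<^sub>R w i)"
      by (simp add: c(1) scaleR_add_right scaleR_sum_right)
    moreover have "\<forall>i\<in>I. 0 \<le> r * c i \<and> r * c i \<le> r * \<alpha> i" using c(2) assms by auto
    ultimately show "x \<in> zonotope I w p (\<lambda>i. r * \<alpha> i)" by (auto intro: zonotopeI)
  qed
  then show ?thesis using measure_lebesgue_affine[of r] assms by simp
qed

lemma zonotope_shrink_to_volume_1:
  fixes w :: "'i \<Rightarrow> 'a::euclidean_space"
  assumes "\<And>i. i \<in> I \<Longrightarrow> 0 \<le> \<alpha> i" and "1 \<le> measure lebesgue (zonotope I w p \<alpha>)"
  obtains \<beta> where "\<And>i. i \<in> I \<Longrightarrow> 0 \<le> \<beta> i" "zonotope I w p \<beta> \<subseteq> zonotope I w p \<alpha>"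
    "measure lebesgue (zonotope I w p \<beta>) = 1"
proof -
  define V where "V = measure lebesgue (zonotope I w p \<alpha>)"
  \<comment> \<open>This ratio brings the volume to one; \<open>V \<ge> 1\<close> gives
    \<open>r \<le> 1\<close>, so the scaled zonotope stays inside.\<close>
  define r where "r = root DIM('a) (1 / V)"
  have r: "0 < r" "r \<le> 1" "r ^ DIM('a) * V = 1"
    using assms(2) by (auto simp: r_def V_def)
  show thesis
  proof (rule that[of "\<lambda>i. r * \<alpha> i"])
    show "zonotope I w p (\<lambda>i. r * \<alpha> i) \<subseteq> zonotope I w p \<alpha>"
      using r assms(1) by (intro zonotope_mono mult_left_le_one_le) auto
    show "measure lebesgue (zonotope I w p (\<lambda>i. r * \<alpha> i)) = 1"
      using measure_zonotope_scaled[OF r(1), of I w p \<alpha>] r(3) by (simp add: V_def)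
  qed (use r assms(1) in auto)
qed

subsection \<open>The parameter space of zonotopes\<close>

text \<open>The volume is bounded below rather than fixed because mixing preserves the lower bound
  but in general not equality.\<close>

definition contains_big_zonotope ::
    "'i set \<Rightarrow> ('i \<Rightarrow> 'a::euclidean_space) \<Rightarrow> 'a set \<Rightarrow> 'a \<Rightarrow> ('i \<Rightarrow> real) \<Rightarrow> bool" where
  "contains_big_zonotope I w C p \<alpha> \<longleftrightarrow> (\<forall>i\<in>I. 0 \<le> \<alpha> i) \<and> zonotope I w p \<alpha> \<subseteq> C \<and>
     1 \<le> measure lebesgue (zonotope I w p \<alpha>)"

lemma contains_big_zonotope_cong:
  "(\<And>i. i \<in> I \<Longrightarrow> \<alpha> i = \<beta> i) \<Longrightarrow> contains_big_zonotope I w C p \<alpha> = contains_big_zonotope I w C p \<beta>"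
  using zonotope_cong[of I \<alpha> \<beta> w p] by (simp add: contains_big_zonotope_def)

lemma contains_big_zonotope_mixture:
  assumes "convex C" "0 < u" "0 < v" "u + v = 1"
    and "contains_big_zonotope I w C p \<alpha>" "contains_big_zonotope I w C q \<beta>"
  shows "contains_big_zonotope I w C (u *\<^sub>R p + v *\<^sub>R q) (\<lambda>i. u * \<alpha> i + v * \<beta> i)"
proof -
  have nonneg: "\<And>i. i \<in> I \<Longrightarrow> 0 \<le> \<alpha> i" "\<And>i. i \<in> I \<Longrightarrow> 0 \<le> \<beta> i"
    and nonneg': "\<And>i. i \<in> I \<Longrightarrow> 0 \<le> u * \<alpha> i + v * \<beta> i"
    using assms by (auto simp: contains_big_zonotope_def)
  let ?Z = "zonotope I w (u *\<^sub>R p + v *\<^sub>R q) (\<lambda>i. u * \<alpha> i + v * \<beta> i)"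
  have mix: "mixture u (zonotope I w p \<alpha>) v (zonotope I w q \<beta>) = ?Z"
    using assms(2,3) nonneg by (intro mixture_zonotope) auto
  have "?Z \<subseteq> C"
    unfolding mix[symmetric] mixture_def
    using assms by (auto simp: contains_big_zonotope_def intro!: convexD)
  moreover have "1 \<le> measure lebesgue ?Z"
  proof (rule measure_mixture_ge[OF assms(2-4)])
    show "mixture u (zonotope I w p \<alpha>) v (zonotope I w q \<beta>) \<subseteq> ?Z" by (simp add: mix)
    show "?Z \<in> lmeasurable"
      using nonneg' by (intro measurable_convex convex_zonotope bounded_zonotope)
  qed (use assms nonneg in \<open>auto simp: contains_big_zonotope_def intro: convex_zonotope bounded_zonotope\<close>)
  ultimately show ?thesis using nonneg' by (simp add: contains_big_zonotope_def)
qed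

section \<open>Side lengths as finitely supported functions\<close>

lemma lookup_scaleR_poly_mapping:
  fixes a :: "'i \<Rightarrow>\<^sub>0 'a::real_vector"
  shows "Poly_Mapping.lookup (r *\<^sub>R a) i = r *\<^sub>R Poly_Mapping.lookup a i"
proof -
  have "finite {i. r *\<^sub>R Poly_Mapping.lookup a i \<noteq> 0}"
    by (rule finite_subset[OF _ finite_lookup[of a]]) auto
  then show ?thesis by (simp add: scaleR_poly_mapping_def)
qed

lemma poly_mapping_in_span_single:
  fixes a :: "'i \<Rightarrow>\<^sub>0 real"
  assumes "finite J" "Poly_Mapping.keys a \<subseteq> J"
  shows "a \<in> span ((\<lambda>i. Poly_Mapping.single i 1) ` J)"
proof -
  have "a = (\<Sum>i\<in>J. Poly_Mapping.lookup a i *\<^sub>R Poly_Mapping.single i 1)"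
  proof (rule poly_mapping_eqI)
    fix j
    have "Poly_Mapping.lookup (\<Sum>i\<in>J. Poly_Mapping.lookup a i *\<^sub>R Poly_Mapping.single i (1::real)) j
        = (\<Sum>i\<in>J. if i = j then Poly_Mapping.lookup a j else 0)"
      by (auto simp: lookup_sum lookup_scaleR_poly_mapping lookup_single when_def intro!: sum.cong)
    also have "\<dots> = Poly_Mapping.lookup a j"
      using assms by (auto simp: in_keys_iff)
    finally show "Poly_Mapping.lookup a j
      = Poly_Mapping.lookup (\<Sum>i\<in>J. Poly_Mapping.lookup a i *\<^sub>R Poly_Mapping.single i 1) j" ..
  qed
  then show ?thesis
    by (metis (no_types, lifting) span_sum span_scale span_base imageI)
qed

text \<open>These at most \<open>DIM('a) + card J\<close> generators supply the dimension bound for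
  \<open>Helly_span\<close>.\<close>

lemma span_Pair_poly_mapping:
  fixes p :: "'a::euclidean_space" and a :: "'i \<Rightarrow>\<^sub>0 real"
  assumes "finite J" "Poly_Mapping.keys a \<subseteq> J"
  shows "(p, a) \<in> span ((\<lambda>b. (b, 0)) ` Basis \<union> (\<lambda>i. (0, Poly_Mapping.single i 1)) ` J)"
    (is "_ \<in> span (?B \<union> ?S)")
proof -
  have lin: "linear (\<lambda>b::'a. (b, 0::'i \<Rightarrow>\<^sub>0 real))" "linear (\<lambda>b::'i \<Rightarrow>\<^sub>0 real. (0::'a, b))"
    by (auto intro!: linearI)
  have "(p, 0) \<in> span ?B"
    unfolding linear_span_image[OF lin(1)] by simp
  moreover have "?S = (\<lambda>b. (0, b)) ` (\<lambda>i. Poly_Mapping.single i 1) ` J" by auto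
  then have "(0, a) \<in> span ?S"
    using poly_mapping_in_span_single[OF assms] by (simp add: linear_span_image[OF lin(2)])
  ultimately have "(p, 0) + (0, a) \<in> span (?B \<union> ?S)"
    by (meson span_add span_mono Un_upper1 Un_upper2 subsetD)
  then show ?thesis by simp
qed

text \<open>The quantifier over \<open>s\<close> is the projection along coordinate
  \<open>k\<close>. Finitely supported functions form a real vector space, and restricting the keys
  to \<open>I - {k}\<close> confines the parameters to a finite-dimensional subspace of it.\<close>

definition reduced_parameters ::
    "'i set \<Rightarrow> 'i \<Rightarrow> ('i \<Rightarrow> 'a::euclidean_space) \<Rightarrow> 'a set \<Rightarrow> ('a \<times> ('i \<Rightarrow>\<^sub>0 real)) set" where
  "reduced_parameters I k w C = {(p, a). Poly_Mapping.keys a \<subseteq> I - {k} \<and>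
     (\<exists>s. contains_big_zonotope I w C p ((Poly_Mapping.lookup a)(k := s)))}"

lemma convex_reduced_parameters:
  fixes w :: "'i \<Rightarrow> 'a::euclidean_space"
  assumes "convex C"
  shows "convex (reduced_parameters I k w C)"
proof (rule convexI)
  fix x y :: "'a \<times> ('i \<Rightarrow>\<^sub>0 real)" and u v :: real
  assume x: "x \<in> reduced_parameters I k w C" and y: "y \<in> reduced_parameters I k w C"
    and uv: "0 \<le> u" "0 \<le> v" "u + v = 1"
  show "u *\<^sub>R x + v *\<^sub>R y \<in> reduced_parameters I k w C"
  \<comment> \<open>Mixing is available for positive weights only; with a zero weight the
    combination is \<open>x\<close> or \<open>y\<close>.\<close>
  proof (cases "u = 0 \<or> v = 0")
    case True
    then show ?thesis using x y uv by auto
  next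
    case False
    obtain p a s where x': "x = (p, a)" "Poly_Mapping.keys a \<subseteq> I - {k}"
        "contains_big_zonotope I w C p ((Poly_Mapping.lookup a)(k := s))"
      using x by (auto simp: reduced_parameters_def)
    obtain q b t where y': "y = (q, b)" "Poly_Mapping.keys b \<subseteq> I - {k}"
        "contains_big_zonotope I w C q ((Poly_Mapping.lookup b)(k := t))"
      using y by (auto simp: reduced_parameters_def)
    \<comment> \<open>The forgotten coordinates mix as well, so \<open>u * s + v * t\<close> is the
      witness for the combination.\<close>
    have "(\<lambda>i. u * ((Poly_Mapping.lookup a)(k := s)) i + v * ((Poly_Mapping.lookup b)(k := t)) i)
        = (Poly_Mapping.lookup (u *\<^sub>R a + v *\<^sub>R b))(k := u * s + v * t)"
      by (auto simp: lookup_add lookup_scaleR_poly_mapping)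
    then have "contains_big_zonotope I w C (u *\<^sub>R p + v *\<^sub>R q)
        ((Poly_Mapping.lookup (u *\<^sub>R a + v *\<^sub>R b))(k := u * s + v * t))"
      using contains_big_zonotope_mixture[OF assms _ _ uv(3) x'(3) y'(3)] False uv by simp
    moreover have "Poly_Mapping.keys (u *\<^sub>R a + v *\<^sub>R b) \<subseteq> I - {k}"
    proof
      fix i assume "i \<in> Poly_Mapping.keys (u *\<^sub>R a + v *\<^sub>R b)"
      then have "i \<in> Poly_Mapping.keys a \<or> i \<in> Poly_Mapping.keys b"
        by (auto simp: in_keys_iff lookup_add lookup_scaleR_poly_mapping)
      then show "i \<in> I - {k}" using x'(2) y'(2) by blast
    qed
    ultimately show ?thesis by (auto simp: reduced_parameters_def x'(1) y'(1))
  qed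
qed

lemma contains_big_zonotope_reduced:
  fixes w :: "'i \<Rightarrow> 'a::euclidean_space"
  assumes "finite I" "contains_big_zonotope I w C p \<alpha>"
  shows "(p, Abs_poly_mapping (\<lambda>i. if i \<in> I - {k} then \<alpha> i else 0)) \<in> reduced_parameters I k w C"
proof -
  define a where "a = Abs_poly_mapping (\<lambda>i. if i \<in> I - {k} then \<alpha> i else 0)"
  have "finite {i. (if i \<in> I - {k} then \<alpha> i else 0) \<noteq> 0}"
    by (rule finite_subset[OF _ assms(1)]) auto
  then have lookup: "Poly_Mapping.lookup a = (\<lambda>i. if i \<in> I - {k} then \<alpha> i else 0)"
    by (simp add: a_def)
  have "contains_big_zonotope I w C p ((Poly_Mapping.lookup a)(k := \<alpha> k))"
    using assms(2) contains_big_zonotope_cong[of I "(Poly_Mapping.lookup a)(k := \<alpha> k)" \<alpha> w C p]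
    by (auto simp: lookup)
  moreover have "Poly_Mapping.keys a \<subseteq> I - {k}"
    by (auto simp: in_keys_iff lookup split: if_splits)
  ultimately show ?thesis
    unfolding a_def[symmetric] reduced_parameters_def by blast
qed

text \<open>The coordinate \<open>k\<close> can be forgotten because the smallest of the finitely many last coordinates
  works for all members of the family at once.\<close>

lemma Inter_reduced_parameters:
  assumes "finite F" "F \<noteq> {}" "(p, a) \<in> (\<Inter>C\<in>F. reduced_parameters I k w C)"
  shows "\<exists>\<alpha>. contains_big_zonotope I w (\<Inter>F) p \<alpha>"
proof -
  have "\<forall>C\<in>F. \<exists>s. contains_big_zonotope I w C p ((Poly_Mapping.lookup a)(k := s))"
    using assms(3) by (auto simp: reduced_parameters_def)
  then obtain s where s: "\<And>C. C \<in> F \<Longrightarrow>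
      contains_big_zonotope I w C p ((Poly_Mapping.lookup a)(k := s C))"
    by metis
  let ?\<alpha> = "(Poly_Mapping.lookup a)(k := Min (s ` F))"
  have "Min (s ` F) \<in> s ` F" using assms(1,2) by (intro Min_in) auto
  then obtain D where D: "D \<in> F" "Min (s ` F) = s D" by auto
  have "zonotope I w p ?\<alpha> \<subseteq> C" if "C \<in> F" for C
  proof -
    have "zonotope I w p ?\<alpha> \<subseteq> zonotope I w p ((Poly_Mapping.lookup a)(k := s C))"
      using assms(1) that by (intro zonotope_mono) auto
    then show ?thesis using s[OF that] by (auto simp: contains_big_zonotope_def)
  qed
  \<comment> \<open>The minimum is attained at \<open>D\<close>, so this zonotope is the one
    belonging to \<open>D\<close>, which provides the signs and the volume bound.\<close>
  then have "contains_big_zonotope I w (\<Inter>F) p ?\<alpha>"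
    using s[OF D(1)] by (auto simp: contains_big_zonotope_def D(2))
  then show ?thesis by blast
qed

section \<open>Helly's theorem applied to the parameter sets\<close>

lemma zonotope_with_directions_iff:
  "zonotope_with_directions k v Z \<longleftrightarrow> (\<exists>p \<alpha>. (\<forall>i\<in>{1..k}. 0 \<le> \<alpha> i) \<and> Z = zonotope {1..k} v p \<alpha>)"
proof -
  have "(\<forall>i\<in>{1..k}. 0 \<le> \<alpha> i) \<and> Z = (+) p ` (\<Sum>i=1..k. closed_segment 0 (\<alpha> i *\<^sub>R v i))
      \<longleftrightarrow> (\<forall>i\<in>{1..k}. 0 \<le> \<alpha> i) \<and> Z = zonotope {1..k} v p \<alpha>" for p \<alpha>
    using zonotope_eq_Minkowski_sum[of "{1..k}" \<alpha> v p] by auto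
  then show ?thesis unfolding zonotope_with_directions_def by simp
qed

theorem theorem1p6:
  fixes k :: nat and v :: "nat \<Rightarrow> real ^ 'd" and F :: "(real ^ 'd) set set"
  assumes "k \<ge> CARD('d)"
    and "\<And>i. i \<in> {1..k} \<Longrightarrow> v i \<noteq> 0"
    and "finite F"
    and "card F \<ge> k + CARD('d)"
    and "\<And>C. C \<in> F \<Longrightarrow> convex C"
    and "\<And>G. G \<subseteq> F \<Longrightarrow> card G = k + CARD('d) \<Longrightarrow>
           \<exists>Z. zonotope_with_directions k v Z \<and> measure lebesgue Z = 1 \<and> Z \<subseteq> \<Inter>G"
  shows "\<exists>Z. zonotope_with_directions k v Z \<and> measure lebesgue Z = 1 \<and> Z \<subseteq> \<Inter>F"
proof -
  let ?I = "{1..k}"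
  let ?P = "reduced_parameters ?I k v"
  let ?B = "(\<lambda>b::real^'d. (b, 0::nat \<Rightarrow>\<^sub>0 real)) ` Basis"
  let ?S = "(\<lambda>i. (0::real^'d, Poly_Mapping.single i (1::real))) ` (?I - {k})"
  \<comment> \<open>The dimension left after the last side length is projected away, so that Helly's
    theorem asks for \<open>?n + 1 = k + CARD('d)\<close> sets; \<open>k \<ge> 1\<close> makes the
    natural-number subtraction exact.\<close>
  let ?n = "k - 1 + CARD('d)"
  have "k \<ge> 1" using assms(1) zero_less_card_finite[where 'a='d] by linarith
  then have n: "?n + 1 = k + CARD('d)" by simp
  have "(\<Inter>C\<in>F. ?P C) \<noteq> {}"
  proof (rule Helly_span[where T = "?B \<union> ?S" and n = ?n])
    have "card ?B \<le> CARD('d)"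
      using card_image_le[OF finite_Basis, of "\<lambda>b::real^'d. (b, 0::nat \<Rightarrow>\<^sub>0 real)"] by simp
    moreover have "card ?S \<le> k - 1"
      using card_image_le[of "?I - {k}" "\<lambda>i. (0::real^'d, Poly_Mapping.single i (1::real))"] \<open>k \<ge> 1\<close>
      by simp
    ultimately show "card (?B \<union> ?S) \<le> ?n"
      using card_Un_le[of ?B ?S] by linarith
  next
    show "?P C \<subseteq> span (?B \<union> ?S)" for C
      using span_Pair_poly_mapping[of "?I - {k}"] by (auto simp: reduced_parameters_def)
  next
    \<comment> \<open>A single zonotope inside \<open>\<Inter>G\<close> lies in every member of
      \<open>G\<close>, so its parameters without side length \<open>k\<close> are a common point of
      the parameter sets.\<close>
    fix G assume G: "G \<subseteq> F" "card G = ?n + 1"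
    then obtain p \<alpha> where "\<forall>i\<in>?I. 0 \<le> \<alpha> i" "measure lebesgue (zonotope ?I v p \<alpha>) = 1"
        "zonotope ?I v p \<alpha> \<subseteq> \<Inter>G"
      using assms(6)[of G] unfolding n zonotope_with_directions_iff by blast
    then have "contains_big_zonotope ?I v C p \<alpha>" if "C \<in> G" for C
      using that by (auto simp: contains_big_zonotope_def)
    then show "(\<Inter>C\<in>G. ?P C) \<noteq> {}"
      using contains_big_zonotope_reduced[of ?I v _ p \<alpha> k] by blast
  qed (use assms n in \<open>auto intro: convex_reduced_parameters\<close>)
  then obtain p a where "(p, a) \<in> (\<Inter>C\<in>F. ?P C)" by fast
  \<comment> \<open>The smallest last side length is a minimum over \<open>F\<close>, hence
    \<open>F\<close> must be nonempty.\<close>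
  moreover have "F \<noteq> {}" using assms(4) \<open>k \<ge> 1\<close> by auto
  ultimately obtain \<alpha> where \<alpha>: "contains_big_zonotope ?I v (\<Inter>F) p \<alpha>"
    using Inter_reduced_parameters[OF assms(3), of p a ?I k v] by auto
  obtain \<beta> where "\<And>i. i \<in> ?I \<Longrightarrow> 0 \<le> \<beta> i" "zonotope ?I v p \<beta> \<subseteq> zonotope ?I v p \<alpha>"
      "measure lebesgue (zonotope ?I v p \<beta>) = 1"
    by (rule zonotope_shrink_to_volume_1[of ?I \<alpha> v p])
      (use \<alpha> in \<open>auto simp: contains_big_zonotope_def\<close>)
  moreover have "zonotope ?I v p \<alpha> \<subseteq> \<Inter>F" using \<alpha> by (simp add: contains_big_zonotope_def)
  ultimately show ?thesis
    unfolding zonotope_with_directions_iff by (blast intro: subset_trans)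
qed

end
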